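(* Let $\mathcal{D}_{\mathrm{cal}}=\{(\boldsymbol{x}_i,y_i)\}_{i=1}^n$ be the clean calibration set, let $s:\mathcal{X}\times\mathcal{Y}\to\mathbb{R}$ be a score function, let $\alpha\in(0,1)$, let $0\le k\le n$ be an integer, and let $\mathcal{B}$ be a threat model. Let $\tilde{\mathcal{D}}_{\mathrm{cal}}=\{(\tilde{\boldsymbol{x}}_i,y_i)\}_{i=1}^n$ be any (possibly random, adversarially chosen) poisoned calibration set in $\mathbb{B}_{k,\mathcal{B}}(\mathcal{D}_{\mathrm{cal}})$, i.e. $\tilde{\boldsymbol{x}}_i\in\mathcal{B}(\boldsymbol{x}_i)$ for all $i$ and $\tilde{\boldsymbol{x}}_i\ne\boldsymbol{x}_i$ for at most $k$ indices $i$. Let $\underline{q_\alpha}$ be the optimal value of $$\min_{\boldsymbol{z}_1,\dots,\boldsymbol{z}_n\in\mathcal{X}}\ \mathrm{Quant}\left(\alpha;\{s(\boldsymbol{z}_i,y_i)\}_{i=1}^n\right)\quad\text{s.t.}\quad \boldsymbol{z}_i\in\mathcal{B}^{-1}(\tilde{\boldsymbol{x}}_i)\ \text{ for all } i=1,\dots,n,\qquad \sum_{i=1}^n\mathbf{1}[\boldsymbol{z}_i\ne\tilde{\boldsymbol{x}}_i]\le k .$$ Define the conservative prediction sets $\overline{\mathcal{C}}_\alpha(\boldsymbol{x})=\{y\in\mathcal{Y}:s(\boldsymbol{x},y)\ge\underline{q_\alpha}\}$. Then for any $(\boldsymbol{x}_{n+1},y_{n+1})$ exchangeable with the clean calibration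 set $\mathcal{D}_{\mathrm{cal}}$, $$\Pr\left[y_{n+1}\in\overline{\mathcal{C}}_\alpha(\boldsymbol{x}_{n+1})\right]\ge1-\alpha.$$
   Context: $\mathcal{X}$ is the input space and $\mathcal{Y}$ is a finite label set. All functions and random elements are assumed measurable as needed. "$(\boldsymbol{x}_{n+1},y_{n+1})$ exchangeable with $\mathcal{D}_{\mathrm{cal}}$" means that $(\boldsymbol{x}_1,y_1),\dots,(\boldsymbol{x}_{n+1},y_{n+1})$ are exchangeable random elements of $\mathcal{X}\times\mathcal{Y}$. Quantile convention: for a finite family $A$ of $n$ real numbers and $\tau\in(0,1)$, $\mathrm{Quant}(\tau;A)$ is the $\lfloor\tau(n+1)\rfloor$-th smallest element of $A$ (counted with multiplicity), and $-\infty$ if $\lfloor\tau(n+1)\rfloor=0$. The optimal value of the minimization is understood as an infimum in $[-\infty,\infty]$. Threat model: a map $\mathcal{B}$ assigning to each clean input $\boldsymbol{x}\in\mathcal{X}$ the set $\mathcal{B}(\boldsymbol{x})\subseteq\mathcal{X}$ of allowed perturbed inputs. Its reversal is $\mathcal{B}^{-1}(\boldsymbol{x}')=\{\boldsymbol{z}\in\mathcal{X}:\boldsymbol{x}'\in\mathcal{B}(\boldsymbol{z})\}$; for symmetric threat models such as the ball $\{\tilde{\boldsymbol{x}}:\|\tilde{\boldsymbol{x}}-\boldsymbol{x}\|_2\le r\}$ one has $\mathcal{B}^{-1}=\mathcal{B}$. *)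

theory Defs
  imports "HOL-Probability.Probability" "HOL-Library.Multiset"
begin

definition exchangeable ::
    "'w measure \<Rightarrow> 'a measure \<Rightarrow> 'i set \<Rightarrow> ('i \<Rightarrow> 'w \<Rightarrow> 'a) \<Rightarrow> bool" where
  "exchangeable M N I Z \<longleftrightarrow>
     (\<forall>i\<in>I. Z i \<in> measurable M N) \<and>
     (\<forall>\<pi>. \<pi> permutes I \<longrightarrow>
        distr M (PiM I (\<lambda>_. N)) (\<lambda>w. \<lambda>i\<in>I. Z (\<pi> i) w) =
        distr M (PiM I (\<lambda>_. N)) (\<lambda>w. \<lambda>i\<in>I. Z i w))"

text \<open>
  The index below is 1-based in the mathematics and 0-based in the list. For \<open>0 < \<tau> < 1\<close> it
  never exceeds the size of the family.
\<close>

definition Quant :: "real \<Rightarrow> real multiset \<Rightarrow> ereal" where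
  "Quant \<tau> A =
     (let m = nat \<lfloor>\<tau> * (real (size A) + 1)\<rfloor>
      in if m = 0 then -\<infinity> else ereal (sorted_list_of_multiset A ! (m - 1)))"

text \<open>
  Data sets of size \<open>n\<close> are families of labelled inputs of which only the indices \<open>1, \<dots>, n\<close>
  matter.
\<close>

definition poison_ball ::
    "nat \<Rightarrow> nat \<Rightarrow> ('x \<Rightarrow> 'x set) \<Rightarrow> (nat \<Rightarrow> 'x \<times> 'y) \<Rightarrow> (nat \<Rightarrow> 'x \<times> 'y) set" where
  "poison_ball n k B D =
     {D'. (\<forall>i\<in>{1..n}. fst (D' i) \<in> B (fst (D i)) \<and> snd (D' i) = snd (D i)) \<and>
          card {i\<in>{1..n}. fst (D' i) \<noteq> fst (D i)} \<le> k}"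

definition threat_reversal :: "'x set \<Rightarrow> ('x \<Rightarrow> 'x set) \<Rightarrow> 'x \<Rightarrow> 'x set" where
  "threat_reversal \<X> B x' = {z\<in>\<X>. x' \<in> B z}"

definition feasible_inputs ::
    "'x set \<Rightarrow> ('x \<Rightarrow> 'x set) \<Rightarrow> nat \<Rightarrow> nat \<Rightarrow> (nat \<Rightarrow> 'x \<times> 'y) \<Rightarrow> (nat \<Rightarrow> 'x) set" where
  "feasible_inputs \<X> B n k D' =
     {z \<in> {1..n} \<rightarrow> \<X>.
        (\<forall>i\<in>{1..n}. z i \<in> threat_reversal \<X> B (fst (D' i))) \<and>
        (\<Sum>i=1..n. of_bool (z i \<noteq> fst (D' i))) \<le> k}"

definition lower_quantile ::
    "'x set \<Rightarrow> ('x \<Rightarrow> 'x set) \<Rightarrow> ('x \<times> 'y \<Rightarrow> real) \<Rightarrow> nat \<Rightarrow> nat \<Rightarrow> real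
      \<Rightarrow> (nat \<Rightarrow> 'x \<times> 'y) \<Rightarrow> ereal" where
  "lower_quantile \<X> B s n k \<alpha> D' =
     (INF z \<in> feasible_inputs \<X> B n k D'.
        Quant \<alpha> (image_mset (\<lambda>i. s (z i, snd (D' i))) (mset_set {1..n})))"

definition conservative_set ::
    "'y set \<Rightarrow> ('x \<times> 'y \<Rightarrow> real) \<Rightarrow> ereal \<Rightarrow> 'x \<Rightarrow> 'y set" where
  "conservative_set \<Y> s q x = {y\<in>\<Y>. ereal (s (x, y)) \<ge> q}"

end

(* The clean inputs are feasible for the minimization, so the lower quantile is at most the
   quantile of the clean scores. Hence, up to a null set, a miss forces the test score to be among
   the m = floor (alpha (n + 1)) smallest of the n + 1 clean scores, in the sense that at most m
   scores are \<le> it. At most m indices have this property, and by exchangeability all of them have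
   it with the same probability, which is therefore at most m / (n + 1) \<le> alpha. *)
theory Submission
  imports Defs
begin

text \<open>Sortedness keeps every entry from position \<open>j\<close> on above \<open>y\<close>,
  so only the first \<open>j\<close> entries can survive the filter.\<close>

lemma sorted_length_filter_le_nth:
  fixes xs :: "'a::linorder list"
  assumes "sorted xs" "j < length xs" "y < xs ! j"
  shows "length (filter (\<lambda>x. x \<le> y) xs) \<le> j"
proof -
  have "filter (\<lambda>x. x \<le> y) (drop j xs) = []"
  proof (rule filter_False, rule ballI)
    fix x assume "x \<in> set (drop j xs)"
    then obtain i where "i < length xs - j" "x = xs ! (j + i)"
      by (auto simp: in_set_conv_nth)
    then have "xs ! j \<le> x"
      using assms(1) by (auto intro: sorted_nth_mono)
    with assms(3) show "\<not> x \<le> y" by auto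
  qed
  moreover have "filter (\<lambda>x. x \<le> y) xs
      = filter (\<lambda>x. x \<le> y) (take j xs) @ filter (\<lambda>x. x \<le> y) (drop j xs)"
    by (metis append_take_drop_id filter_append)
  ultimately have "length (filter (\<lambda>x. x \<le> y) xs) = length (filter (\<lambda>x. x \<le> y) (take j xs))"
    by simp
  also have "\<dots> \<le> length (take j xs)"
    by (rule length_filter_le)
  also have "\<dots> \<le> j" by simp
  finally show ?thesis .
qed

text \<open>With \<open>m\<close> the index of the quantile, its value sits at list position
  \<open>m - 1\<close>, so at most \<open>m - 1\<close> elements can be \<le> \<open>y\<close>. The
  strict inequality leaves room for one further element, later the test score itself.\<close>

lemma size_filter_less_if_less_Quant:
  assumes "0 < \<tau>" "\<tau> < 1" "ereal y < Quant \<tau> A"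
  shows "size {#x \<in># A. x \<le> y#} < nat \<lfloor>\<tau> * (real (size A) + 1)\<rfloor>"
proof -
  define m where "m = nat \<lfloor>\<tau> * (real (size A) + 1)\<rfloor>"
  let ?xs = "sorted_list_of_multiset A"
  \<comment> \<open>Since \<tau> < 1, the quantile index does not exceed \<open>size A\<close>, so
    position \<open>m - 1\<close> lies inside the list.\<close>
  have "\<tau> * (real (size A) + 1) < 1 * (real (size A) + 1)"
    using assms by (intro mult_strict_right_mono) auto
  then have "\<lfloor>\<tau> * (real (size A) + 1)\<rfloor> < int (size A) + 1"
    by (simp only: floor_less_iff of_int_add of_int_of_nat_eq of_int_1 mult_1_left)
  then have "m \<le> size A"
    unfolding m_def by simp
  \<comment> \<open>For \<open>m = 0\<close> the quantile is -\<infinity>, and no real number lies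
    below it.\<close>
  have "m \<noteq> 0"
    using assms(3) unfolding Quant_def Let_def m_def[symmetric] by (auto split: if_splits)
  then have lt: "y < ?xs ! (m - 1)"
    using assms(3) unfolding Quant_def Let_def m_def[symmetric] by simp
  have len: "length ?xs = size A"
    by (metis mset_sorted_list_of_multiset size_mset)
  have "length (filter (\<lambda>x. x \<le> y) ?xs) \<le> m - 1"
    using \<open>m \<noteq> 0\<close> \<open>m \<le> size A\<close> lt len
    by (intro sorted_length_filter_le_nth) auto
  moreover have "size {#x \<in># A. x \<le> y#} = length (filter (\<lambda>x. x \<le> y) ?xs)"
    by (metis mset_filter mset_sorted_list_of_multiset size_mset)
  ultimately show ?thesis
    using \<open>m \<noteq> 0\<close> unfolding m_def[symmetric] by simp
qed

lemma card_le_if_less_Quant: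
  fixes f :: "nat \<Rightarrow> real"
  assumes "0 < \<tau>" "\<tau> < 1" "ereal y < Quant \<tau> (image_mset f (mset_set {1..n}))"
  shows "card {i\<in>{1..n}. f i \<le> y} < nat \<lfloor>\<tau> * (real n + 1)\<rfloor>"
proof -
  have "size {#x \<in># image_mset f (mset_set {1..n}). x \<le> y#} = card {i\<in>{1..n}. f i \<le> y}"
    by (simp add: filter_mset_image_mset filter_mset_mset_set)
  then show ?thesis
    using size_filter_less_if_less_Quant[OF assms] by simp
qed

text \<open>Take the index of low rank with the largest value: all indices of low rank lie in its
  sublevel set, which has at most \<open>m\<close> elements. Ties count in full towards the rank, so
  repeated values do no harm.\<close>

lemma card_low_ranks:
  fixes f :: "'i \<Rightarrow> 'a::linorder"
  assumes "finite I"
  shows "card {j\<in>I. card {i\<in>I. f i \<le> f j} \<le> m} \<le> m"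
proof -
  let ?J = "{j\<in>I. card {i\<in>I. f i \<le> f j} \<le> m}"
  show ?thesis
  proof (cases "?J = {}")
    case False
    have fin: "finite (f ` ?J)" using assms by simp
    with False have "Max (f ` ?J) \<in> f ` ?J" by (intro Max_in) auto
    then obtain j where j: "j \<in> ?J" "f j = Max (f ` ?J)" by auto
    have "?J \<subseteq> {i\<in>I. f i \<le> f j}"
      using fin j(2) by auto
    then have "card ?J \<le> card {i\<in>I. f i \<le> f j}"
      using assms by (intro card_mono) auto
    also have "\<dots> \<le> m" using j by simp
    finally show ?thesis .
  next
    case True
    then show ?thesis by (metis card.empty le0)
  qed
qed

lemma sets_rank_le:
  fixes f :: "'i \<Rightarrow> 'a \<Rightarrow> real"
  assumes "finite I" "j \<in> I" "\<And>i. i \<in> I \<Longrightarrow> f i \<in> borel_measurable N"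
  shows "{v \<in> space N. card {i\<in>I. f i v \<le> f j v} \<le> m} \<in> sets N"
proof -
  \<comment> \<open>Written as a finite sum of indicators, the rank is visibly a measurable function
    of \<open>v\<close>.\<close>
  have "card {i\<in>I. f i v \<le> f j v} = (\<Sum>i\<in>I. if f i v \<le> f j v then 1 else 0)" for v
    using assms(1) by (simp add: sum.If_cases Int_def)
  moreover have "(\<lambda>v. \<Sum>i\<in>I. if f i v \<le> f j v then 1 else 0 :: nat)
      \<in> measurable N (count_space UNIV)"
    using assms by (intro measurable_sum_nat measurable_If) (auto intro: borel_measurable_le)
  ultimately have "(\<lambda>v. card {i\<in>I. f i v \<le> f j v}) \<in> measurable N (count_space UNIV)"
    by simp
  from measurable_sets[OF this, of "{..m}"] show ?thesis
    by (simp add: vimage_def Int_def conj_commute)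
qed

text \<open>The expected number of indices of rank at most \<open>m\<close> is at most
  \<open>m\<close>, because the number itself is at every point. Exchangeability makes all
  \<open>card I\<close> indices contribute equally to this expectation.\<close>

lemma prob_rank_le:
  fixes s :: "'a \<Rightarrow> real"
  assumes "prob_space M" "exchangeable M N I Z" "s \<in> borel_measurable N" "finite I" "l \<in> I"
  shows "real (card I) * measure M {w \<in> space M. card {i\<in>I. s (Z i w) \<le> s (Z l w)} \<le> m}
           \<le> real m"
proof -
  interpret prob_space M by fact
  have Z: "Z i \<in> measurable M N" if "i \<in> I" for i
    using assms(2) that by (auto simp: exchangeable_def)
  then have sZ: "(\<lambda>w. s (Z i w)) \<in> borel_measurable M" if "i \<in> I" for i
    using that assms(3) by (auto intro: measurable_compose)
  define F where "F j = {w \<in> space M. card {i\<in>I. s (Z i w) \<le> s (Z j w)} \<le> m}" for j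
  have F: "F j \<in> sets M" if "j \<in> I" for j
    unfolding F_def using sets_rank_le[OF assms(4) that sZ] .
  define P where "P = PiM I (\<lambda>_. N)"
  \<comment> \<open>\<open>G\<close> is the event \<open>F l\<close> expressed through the
    coordinates of the product space; exchangeability is an equality of laws there.\<close>
  define G where "G = {v \<in> space P. card {i\<in>I. s (v i) \<le> s (v l)} \<le> m}"
  have G: "G \<in> sets P"
    unfolding G_def
  proof (rule sets_rank_le[OF assms(4,5)])
    fix i assume "i \<in> I"
    then show "(\<lambda>v. s (v i)) \<in> borel_measurable P"
      unfolding P_def using assms(3)
      by (intro measurable_compose[OF measurable_component_singleton])
  qed
  have eq: "measure M (F j) = measure M (F l)" if "j \<in> I" for j
  proof -
    \<comment> \<open>Relabelling by \<pi> only reindexes the scores being counted, while the score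
      compared against becomes that of \<pi> \<open>l\<close>. Hence the preimage of
      \<open>G\<close> under the relabelled family is \<open>F (\<pi> l)\<close>.\<close>
    have perm: "measure M (F (\<pi> l)) = measure (distr M P (\<lambda>w. \<lambda>i\<in>I. Z (\<pi> i) w)) G"
      if \<pi>: "\<pi> permutes I" for \<pi>
    proof -
      have meas: "(\<lambda>w. \<lambda>i\<in>I. Z (\<pi> i) w) \<in> measurable M P"
        unfolding P_def using Z permutes_in_image[OF \<pi>] by (intro measurable_restrict) auto
      have "card {i\<in>I. s (Z (\<pi> i) w) \<le> t} = card {i\<in>I. s (Z i w) \<le> t}" for w t
      proof (rule bij_betw_same_card)
        show "bij_betw \<pi> {i\<in>I. s (Z (\<pi> i) w) \<le> t} {i\<in>I. s (Z i w) \<le> t}"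
        proof (rule bij_betw_imageI)
          show "inj_on \<pi> {i\<in>I. s (Z (\<pi> i) w) \<le> t}"
            using permutes_inj[OF \<pi>] by (auto simp: inj_on_def)
          show "\<pi> ` {i\<in>I. s (Z (\<pi> i) w) \<le> t} = {i\<in>I. s (Z i w) \<le> t}"
            using permutes_in_image[OF \<pi>] permutes_image[OF \<pi>] by fastforce
        qed
      qed
      moreover have "{i\<in>I. s ((\<lambda>i\<in>I. Z (\<pi> i) w) i) \<le> s ((\<lambda>i\<in>I. Z (\<pi> i) w) l)}
          = {i\<in>I. s (Z (\<pi> i) w) \<le> s (Z (\<pi> l) w)}" for w
        using assms(5) by auto
      ultimately have "(\<lambda>w. \<lambda>i\<in>I. Z (\<pi> i) w) -` G \<inter> space M = F (\<pi> l)"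
        using measurable_space[OF meas] unfolding F_def G_def by auto
      then show ?thesis
        using measure_distr[OF meas G] by simp
    qed
    \<comment> \<open>The swap of \<open>l\<close> and \<open>j\<close> turns \<open>F l\<close>
      into \<open>F j\<close>. The unpermuted family is written with \<open>id\<close> below so that
      \<open>perm\<close> applies to both sides.\<close>
    have tr: "Transposition.transpose l j permutes I"
      using assms(5) that by (rule permutes_swap_id)
    have "distr M P (\<lambda>w. \<lambda>i\<in>I. Z (Transposition.transpose l j i) w) = distr M P (\<lambda>w. \<lambda>i\<in>I. Z (id i) w)"
      using assms(2) tr unfolding exchangeable_def P_def id_def by blast
    then show ?thesis
      using perm[OF tr] perm[OF permutes_id] by simp
  qed
  have "real (card I) * measure M (F l) = (\<Sum>j\<in>I. measure M (F j))"
    using eq by simp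
  also have "\<dots> = (\<Sum>j\<in>I. \<integral>w. indicator (F j) w \<partial>M)"
    using F by (intro sum.cong) auto
  also have "\<dots> = (\<integral>w. (\<Sum>j\<in>I. indicator (F j) w) \<partial>M)"
    using F by (intro Bochner_Integration.integral_sum[symmetric])
      (auto simp: integrable_indicator_iff emeasure_eq_measure)
  also have "\<dots> \<le> (\<integral>w. real m \<partial>M)"
  proof (rule integral_mono)
    show "integrable M (\<lambda>w. \<Sum>j\<in>I. indicator (F j) w :: real)"
      using F by (intro Bochner_Integration.integrable_sum)
        (auto simp: integrable_indicator_iff emeasure_eq_measure)
    fix w assume w: "w \<in> space M"
    \<comment> \<open>At a fixed outcome the sum counts the indices of low rank.\<close>
    have "(\<Sum>j\<in>I. indicator (F j) w :: real)
        = real (card {j\<in>I. card {i\<in>I. s (Z i w) \<le> s (Z j w)} \<le> m})"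
      using assms(4) w by (simp add: F_def indicator_def sum.If_cases Int_def)
    also have "\<dots> \<le> real m"
      using card_low_ranks[OF assms(4)] by simp
    finally show "(\<Sum>j\<in>I. indicator (F j) w) \<le> real m" .
  qed simp
  also have "\<dots> = real m"
    by (simp add: prob_space)
  finally show ?thesis
    unfolding F_def .
qed

text \<open>Membership in the reversal is the threat condition read backwards, and the number of
  changed inputs is symmetric in the clean and the poisoned data.\<close>

lemma clean_inputs_feasible:
  assumes "D' \<in> poison_ball n k B D" "\<And>i. i \<in> {1..n} \<Longrightarrow> fst (D i) \<in> \<X>"
  shows "(\<lambda>i. fst (D i)) \<in> feasible_inputs \<X> B n k D'"
proof -
  have "(\<Sum>i=1..n. of_bool (fst (D i) \<noteq> fst (D' i)) :: nat)
      = card {i\<in>{1..n}. fst (D' i) \<noteq> fst (D i)}"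
    by (auto simp: of_bool_def sum.If_cases intro!: arg_cong[where f = card])
  then show ?thesis
    using assms by (auto simp: poison_ball_def feasible_inputs_def threat_reversal_def)
qed

text \<open>Poisoning leaves the labels intact, so the objective at the feasible clean inputs is
  exactly the clean quantile.\<close>

lemma lower_quantile_le_clean:
  assumes "D' \<in> poison_ball n k B D" "\<And>i. i \<in> {1..n} \<Longrightarrow> fst (D i) \<in> \<X>"
  shows "lower_quantile \<X> B s n k \<alpha> D'
           \<le> Quant \<alpha> (image_mset (\<lambda>i. s (D i)) (mset_set {1..n}))"
proof -
  have "image_mset (\<lambda>i. s (fst (D i), snd (D' i))) (mset_set {1..n})
      = image_mset (\<lambda>i. s (D i)) (mset_set {1..n})"
    using assms(1) by (intro image_mset_cong) (auto simp: poison_ball_def)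
  with INF_lower[OF clean_inputs_feasible[OF assms], of
      "\<lambda>z. Quant \<alpha> (image_mset (\<lambda>i. s (z i, snd (D' i))) (mset_set {1..n}))"]
  show ?thesis
    unfolding lower_quantile_def by simp
qed

theorem proposition3p2:
  fixes M :: "'w measure" and MX :: "'x measure" and \<Y> :: "'y set"
    and X X' :: "nat \<Rightarrow> 'w \<Rightarrow> 'x" and Y :: "nat \<Rightarrow> 'w \<Rightarrow> 'y"
    and s :: "'x \<times> 'y \<Rightarrow> real" and B :: "'x \<Rightarrow> 'x set"
    and \<alpha> :: real and n k :: nat
  assumes "prob_space M"
    and "finite \<Y>"
    and "s \<in> borel_measurable (MX \<Otimes>\<^sub>M count_space \<Y>)"
    and "0 < \<alpha>" and "\<alpha> < 1"
    and "k \<le> n"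
    and "\<And>x. x \<in> space MX \<Longrightarrow> B x \<subseteq> space MX"
    and "exchangeable M (MX \<Otimes>\<^sub>M count_space \<Y>) {1..n + 1} (\<lambda>i w. (X i w, Y i w))"
    and "AE w in M. (\<lambda>i. (X' i w, Y i w)) \<in> poison_ball n k B (\<lambda>i. (X i w, Y i w))"
    and "{w \<in> space M. Y (n + 1) w \<in> conservative_set \<Y> s
            (lower_quantile (space MX) B s n k \<alpha> (\<lambda>i. (X' i w, Y i w))) (X (n + 1) w)} \<in> sets M"
  shows "measure M {w \<in> space M. Y (n + 1) w \<in> conservative_set \<Y> s
            (lower_quantile (space MX) B s n k \<alpha> (\<lambda>i. (X' i w, Y i w))) (X (n + 1) w)} \<ge> 1 - \<alpha>"
proof -
  interpret prob_space M by fact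
  define E where "E = {w \<in> space M. Y (n + 1) w \<in> conservative_set \<Y> s
            (lower_quantile (space MX) B s n k \<alpha> (\<lambda>i. (X' i w, Y i w))) (X (n + 1) w)}"
  define Z where "Z = (\<lambda>i w. (X i w, Y i w))"
  define m where "m = nat \<lfloor>\<alpha> * (real n + 1)\<rfloor>"
  define F where
    "F = {w \<in> space M. card {i\<in>{1..n + 1}. s (Z i w) \<le> s (Z (n + 1) w)} \<le> m}"
  have Z: "Z i \<in> measurable M (MX \<Otimes>\<^sub>M count_space \<Y>)" if "i \<in> {1..n + 1}" for i
    using assms(8) that unfolding exchangeable_def Z_def by blast
  have XY: "X i w \<in> space MX \<and> Y i w \<in> \<Y>" if "i \<in> {1..n + 1}" "w \<in> space M" for i w
    using measurable_space[OF Z[OF that(1)] that(2)] by (auto simp: Z_def space_pair_measure)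
  have F: "F \<in> sets M"
    unfolding F_def
    using assms(3) Z by (intro sets_rank_le) (auto intro: measurable_compose)
  \<comment> \<open>The poisoning constraint holds only almost surely, so the inclusion of the miss
    event in \<open>F\<close> does too.\<close>
  have "AE w in M. w \<in> space M - E \<longrightarrow> w \<in> F"
    using assms(9)
  proof (rule AE_mp, intro AE_I2 impI)
    fix w
    assume w: "w \<in> space M"
      and ball: "(\<lambda>i. (X' i w, Y i w)) \<in> poison_ball n k B (\<lambda>i. (X i w, Y i w))"
      and "w \<in> space M - E"
    \<comment> \<open>By \<open>XY\<close> the test label lies in the label set, so a miss can only
      come from a score below the threshold.\<close>
    then have "ereal (s (Z (n + 1) w))
        < lower_quantile (space MX) B s n k \<alpha> (\<lambda>i. (X' i w, Y i w))"
      using XY[of "n + 1" w] by (auto simp: E_def conservative_set_def Z_def not_le)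
    also have "\<dots> \<le> Quant \<alpha> (image_mset (\<lambda>i. s (Z i w)) (mset_set {1..n}))"
      unfolding Z_def using XY w by (intro lower_quantile_le_clean[OF ball]) auto
    finally have "card {i\<in>{1..n}. s (Z i w) \<le> s (Z (n + 1) w)} < m"
      unfolding m_def by (intro card_le_if_less_Quant assms)
    \<comment> \<open>The test score counts itself, which raises the count by one; the strict bound
      just obtained absorbs this.\<close>
    moreover have "{i\<in>{1..n + 1}. s (Z i w) \<le> s (Z (n + 1) w)}
        = insert (n + 1) {i\<in>{1..n}. s (Z i w) \<le> s (Z (n + 1) w)}"
      by (auto simp: le_Suc_eq)
    ultimately have "card {i\<in>{1..n + 1}. s (Z i w) \<le> s (Z (n + 1) w)} \<le> m"
      by simp
    with w show "w \<in> F" by (simp add: F_def)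
  qed
  then have "prob (space M - E) \<le> prob F"
    using F by (intro finite_measure_mono_AE) auto
  moreover have "prob (space M - E) = 1 - prob E"
    using assms(10) unfolding E_def[symmetric] by (rule prob_compl)
  moreover have "prob F \<le> \<alpha>"
  proof -
    \<comment> \<open>The factor \<open>n + 1\<close> in the quantile index matches the number of
      exchangeable scores, so dividing by it leaves \<alpha>.\<close>
    have "real (card {1..n + 1}) * prob F \<le> real m"
      unfolding F_def using assms(8)[folded Z_def]
      by (intro prob_rank_le[OF assms(1) _ assms(3)]) auto
    also have "real m \<le> \<alpha> * (real n + 1)"
      unfolding m_def using assms(4) by simp
    finally have "(real n + 1) * prob F \<le> (real n + 1) * \<alpha>"
      by (simp add: algebra_simps)
    then show ?thesis
      by (rule mult_left_le_imp_le) simp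
  qed
  ultimately show ?thesis
    unfolding E_def by simp
qed

end
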